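(* For $t\ge 0$, the expectation and variance of the time to sale $T_t$ are $$E[T_t]=\frac1\lambda\phi(\mu(t))\int_{\mu_0}^{\mu(t)}\frac{dw}{\phi(w)^2},$$ $$\mathrm{Var}[T_t]=\frac{1}{\lambda^2}\left[2\phi(\mu(t))\int_{\mu_0}^{\mu(t)}\frac{1}{\phi(u)}\int_{\mu_0}^{u}\frac{1}{\phi(w)^2}\,dw\,du-\left[\phi(\mu(t))\int_{\mu_0}^{\mu(t)}\frac{dw}{\phi(w)^2}\right]^2\right].$$
   Context: Data: $\lambda>0$; $F,F_0$ are cumulative distribution functions (CDFs) on $\mathbb{R}$ (offer distribution and residual price distribution); $X\sim F$, $X_0\sim F_0$; $y_+=\max(y,0)$; $\mu_0=E[X_0]$; $M=\sup\{x : F(x)<1\}\in(-\infty,+\infty]$. Standing assumptions: $E[X_+]<\infty$, $E[|X_0|]<\infty$, $0\le\mu_0<M$. Define $\phi(x)=\int_x^\infty[1-F(u)]\,du$ and $\Psi(x)=\int_{\mu_0}^x\frac{du}{\phi(u)}$ for $x\in[\mu_0,M)$. The optimal policy is the function $\mu:[0,\infty)\to[\mu_0,M)$, $\mu(t)=\Psi^{-1}(\lambda t)$; equivalently, the solution of $\mu'(t)=\lambda\phi(\mu(t))$, $\mu(0)=\mu_0$. Bidding process with marketing period $t\ge 0$ under the optimal policy: let $D_1,D_2,\dots$ be exponential with rate $\lambda$ (inter-arrival times of offers) and $X_1,X_2,\dots$ be distributed according to $F$ (offer values), all independent. The time remaining to the deadline when the $i$-th offer arrives is $t_i=\max(t_{i-1}-D_i,0)$,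 with initial value $t$ (that is, $t_i=(t-D_1-\dots-D_i)_+$). An offer $X_i$ with $t_i>0$ is accepted if and only if $X_i\ge\mu(t_i)$; at the first accepted offer $i$ the process ends, with time to sale $T_t=t-t_i$. If no offer is accepted before the remaining time reaches $0$, then $T_t=t$. *)

theory Defs
  imports "HOL-Probability.Probability"
begin

definition is_cdf :: "(real \<Rightarrow> real) \<Rightarrow> bool" where
  "is_cdf F \<longleftrightarrow> mono F \<and> (\<forall>a. continuous (at_right a) F) \<and>
     (F \<longlongrightarrow> 0) at_bot \<and> (F \<longlongrightarrow> 1) at_top"

text \<open>Moments of a CDF are taken with respect to the law it generates, \<^term>\<open>interval_measure F\<close>
  (the unique Borel probability measure whose \<^const>\<open>cdf\<close> is \<open>F\<close>).\<close>

definition cdf_mean :: "(real \<Rightarrow> real) \<Rightarrow> real" where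
  "cdf_mean F = (LINT x|interval_measure F. x)"

definition upper_end :: "(real \<Rightarrow> real) \<Rightarrow> ereal" where
  "upper_end F = (SUP x\<in>{x. F x < 1}. ereal x)"

definition phi :: "(real \<Rightarrow> real) \<Rightarrow> real \<Rightarrow> real" where
  "phi F x = (LINT u:{x..}|lborel. 1 - F u)"

definition Psi :: "(real \<Rightarrow> real) \<Rightarrow> real \<Rightarrow> real \<Rightarrow> real" where
  "Psi F m x = (LINT u:{m..x}|lborel. 1 / phi F u)"

text \<open>The optimal policy is the inverse of \<^const>\<open>Psi\<close> on \<open>[m, M)\<close>, evaluated at \<open>lam * t\<close>;
  it is meaningful for \<open>t \<ge> 0\<close>.\<close>

definition policy :: "real \<Rightarrow> (real \<Rightarrow> real) \<Rightarrow> real \<Rightarrow> real \<Rightarrow> real" where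
  "policy lam F m t =
     the_inv_into {x. m \<le> x \<and> ereal x < upper_end F} (Psi F m) (lam * t)"

text \<open>A sample path is given by inter-arrival times \<open>d 1, d 2, \<dots>\<close> and offer values
  \<open>x 1, x 2, \<dots>\<close>; the entries at index \<open>0\<close> are never used.
  \<open>remaining d t i\<close> is the time left to the deadline when the \<open>i\<close>-th offer arrives.\<close>

primrec remaining :: "(nat \<Rightarrow> real) \<Rightarrow> real \<Rightarrow> nat \<Rightarrow> real" where
  "remaining d t 0 = t"
| "remaining d t (Suc i) = max (remaining d t i - d (Suc i)) 0"

definition accepted ::
    "(real \<Rightarrow> real) \<Rightarrow> (nat \<Rightarrow> real) \<Rightarrow> (nat \<Rightarrow> real) \<Rightarrow> real \<Rightarrow> nat \<Rightarrow> bool" where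
  "accepted pol d x t i \<longleftrightarrow>
     1 \<le> i \<and> 0 < remaining d t i \<and> pol (remaining d t i) \<le> x i"

definition time_to_sale ::
    "(real \<Rightarrow> real) \<Rightarrow> (nat \<Rightarrow> real) \<Rightarrow> (nat \<Rightarrow> real) \<Rightarrow> real \<Rightarrow> real" where
  "time_to_sale pol d x t =
     (if \<exists>i. accepted pol d x t i
      then t - remaining d t (LEAST i. accepted pol d x t i)
      else t)"

end

theory Submission
  imports Defs
begin

text \<open>Let \<open>R = t - T\<close> be the time that is left when the process ends (\<open>0\<close> if nothing is accepted).
Write \<open>\<lambda>\<close> for \<open>lam\<close> and \<open>\<phi>\<close> for \<open>phi F\<close>. For a test function \<open>K\<close> put \<open>u t = E[K R]\<close> (\<open>expected K t\<close>
below). The process restarts after a rejected first offer with the remaining time as its new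
marketing period, so conditioning on the first offer gives the renewal equation
\<open>exp (\<lambda> t) u t = K 0 + \<integral>\<^sub>0\<^sup>t \<lambda> exp (\<lambda> r) ((1 - F (\<mu> r)) K r + F (\<mu> r) u r) dr\<close>
(\<open>expected_renewal\<close>). Differentiating it, \<open>u' = \<lambda> (1 - F (\<mu> t)) (K - u)\<close>. On the other hand
\<open>\<phi>' = - (1 - F)\<close> and \<open>\<mu>' = \<lambda> \<phi> (\<mu>)\<close> show that \<open>p t = \<phi> (\<mu> t)\<close> satisfies the homogeneous equation
\<open>p' = - \<lambda> (1 - F (\<mu> t)) p\<close>. Division by \<open>p\<close> therefore removes the unknown from the right-hand
side: \<open>((u - K) / p)' = - K' / p\<close>, and \<open>u = K - p J\<close> for the primitive \<open>J\<close> of \<open>K' / p\<close> with \<open>J 0 = 0\<close>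
(\<open>expected_solution\<close>).

For a fixed \<open>t\<close> the test functions \<open>K r = t - r\<close> and \<open>K r = (t - r)\<^sup>2\<close> give the first two moments
of \<open>T\<close>. Their primitives \<open>J\<close> are built from the two integrals of the formulas, taken up to \<open>\<mu> s\<close>
as functions of \<open>s\<close>; they are recognised by differentiation, without a change of variables.

\<open>F\<close> may have atoms, so \<open>\<phi>\<close> need not be differentiable, and an offer equal to the threshold may
have positive probability. Both effects are harmless. \<open>F\<close> is continuous from the right, so
every differential equation above holds for right derivatives at every point, and a
continuous function whose right derivative vanishes is constant
(\<open>zero_right_derivative_imp_constant\<close>). The policy is strictly increasing, so it passes
through the countably many atoms only at countably many times (\<open>AE_rejection_probability\<close>).

The probabilistic part is carried out on the space of sequences of pairs (delay, value),
where the law of a sequence is invariant under prepending an independent pair;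
\<open>process_expectation\<close> transfers the result to the given process.\<close>

section \<open>Calculus with right derivatives\<close>

text \<open>Otherwise \<open>f\<close> ends above a line of small positive slope \<open>\<epsilon>\<close> through its starting point. At the last
point \<open>c\<close> where \<open>f\<close> is not above that line, the right derivative of the difference \<open>h\<close> is
\<open>-\<epsilon>\<close>, so \<open>h\<close> stays nonpositive a little beyond \<open>c\<close>.\<close>
lemma zero_right_derivative_imp_le:
  fixes f :: "real \<Rightarrow> real"
  assumes "a \<le> b" "continuous_on {a..b} f"
    and der: "\<And>x. a \<le> x \<Longrightarrow> x < b \<Longrightarrow> (f has_real_derivative 0) (at_right x)"
  shows "f b \<le> f a"
proof (rule field_le_epsilon)
  fix e :: real assume "e > 0"
  define \<epsilon> where "\<epsilon> = e / (b - a + 1)"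
  have \<epsilon>: "\<epsilon> > 0" "\<epsilon> * (b - a) \<le> e"
    using \<open>e > 0\<close> \<open>a \<le> b\<close> by (auto simp: \<epsilon>_def field_simps)
  define h where "h x = f x - f a - \<epsilon> * (x - a)" for x
  have conth: "continuous_on {a..b} h"
    unfolding h_def using assms(2) by (intro continuous_intros)
  have "h b \<le> 0"
  proof (rule ccontr)
    assume pos: "\<not> h b \<le> 0"
    define Z where "Z = {x \<in> {a..b}. h x \<le> 0}"
    have "closed Z"
      unfolding Z_def using continuous_closed_preimage[OF conth, of "{..0}"]
      by (simp add: vimage_def Int_def)
    moreover have "bounded Z" unfolding Z_def by (rule bounded_subset[of "{a..b}"]) auto
    ultimately have "compact Z" by (simp add: compact_eq_bounded_closed)
    moreover have "a \<in> Z" using \<open>a \<le> b\<close> by (simp add: Z_def h_def)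
    ultimately obtain c where c: "c \<in> Z" "\<And>z. z \<in> Z \<Longrightarrow> z \<le> c"
      using compact_attains_sup[of Z] by blast
    then have "c < b" "a \<le> c" using pos by (auto simp: Z_def less_le)
    have "(h has_real_derivative - \<epsilon>) (at_right c)"
      unfolding h_def using der[OF \<open>a \<le> c\<close> \<open>c < b\<close>]
      by (auto intro!: derivative_eq_intros)
    then obtain d where "d > 0" "\<And>y. 0 < y \<Longrightarrow> y < d \<Longrightarrow> h (c + y) < h c"
      using has_real_derivative_neg_dec_right[of h "-\<epsilon>" c "{c<..}"] \<epsilon>(1) by force
    moreover define y where "y = min (d / 2) (b - c)"
    ultimately have "0 < y" "y \<le> b - c" "h (c + y) < h c"
      using \<open>c < b\<close> by (auto simp: min_def)
    then have "c + y \<in> Z" using c(1) \<open>a \<le> c\<close> by (auto simp: Z_def)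
    then show False using c(2) \<open>0 < y\<close> by force
  qed
  then show "f b \<le> f a + e" using \<epsilon>(2) by (simp add: h_def)
qed

lemma zero_right_derivative_imp_constant:
  fixes f :: "real \<Rightarrow> real"
  assumes "a \<le> b" "continuous_on {a..b} f"
    and der: "\<And>x. a \<le> x \<Longrightarrow> x < b \<Longrightarrow> (f has_real_derivative 0) (at_right x)"
  shows "f b = f a"
proof (rule antisym)
  show "f b \<le> f a" by (rule zero_right_derivative_imp_le[OF assms])
  have "- f b \<le> - f a"
  proof (rule zero_right_derivative_imp_le[OF assms(1)])
    show "((\<lambda>x. - f x) has_real_derivative 0) (at_right x)" if "a \<le> x" "x < b" for x
      using DERIV_minus[OF der[OF that]] by simp
  qed (intro continuous_intros assms)
  then show "f a \<le> f b" by simp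
qed

lemma integral_right_derivative:
  fixes g :: "real \<Rightarrow> real"
  assumes int: "g integrable_on {a..b}" and t: "a \<le> t" "t < b"
    and cont: "continuous (at_right t) g"
  shows "((\<lambda>x. integral {a..x} g) has_real_derivative g t) (at_right t)"
proof -
  have "g integrable_on {t..b}"
    using int t by (auto intro: integrable_subinterval_real)
  then have "((\<lambda>u. integral {t..u} g) has_vector_derivative g t) (at t within {t..b} - {})"
    using t cont by (intro integral_has_vector_derivative_continuous_at)
      (auto simp: at_within_Icc_at_right)
  then have "((\<lambda>u. integral {a..t} g + integral {t..u} g) has_real_derivative g t) (at t within {t..b})"
    by (auto simp: has_real_derivative_iff_has_vector_derivative intro!: derivative_eq_intros)
  then have "((\<lambda>x. integral {a..x} g) has_real_derivative g t) (at t within {t..b})"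
  proof (rule has_field_derivative_transform_within[OF _ zero_less_one])
    fix x assume "x \<in> {t..b}"
    then show "integral {a..t} g + integral {t..x} g = integral {a..x} g"
      using t int by (intro Henstock_Kurzweil_Integration.integral_combine)
        (auto intro: integrable_subinterval_real)
  qed (use t in auto)
  then show ?thesis using t by (simp add: at_within_Icc_at_right)
qed

lemma continuous_on_imp_continuous_at_right:
  fixes f :: "real \<Rightarrow> 'a :: topological_space"
  assumes "continuous_on {a..b} f" "a \<le> t" "t < b"
  shows "continuous (at_right t) f"
proof -
  have "continuous (at t within {a..b}) f"
    using assms by (simp add: continuous_on_eq_continuous_within)
  then have "continuous (at t within {t..b}) f"
    by (rule continuous_within_subset) (use assms in auto)
  then show ?thesis using assms by (simp add: at_within_Icc_at_right)
qed

section \<open>The tail integral of a distribution function\<close>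

locale offer_distribution =
  fixes F :: "real \<Rightarrow> real"
  assumes is_cdf: "is_cdf F"
    and pos_part_integrable: "integrable (interval_measure F) (\<lambda>x. max x 0)"
begin

abbreviation value_law :: "real measure" where "value_law \<equiv> interval_measure F"

lemma F_mono: "x \<le> y \<Longrightarrow> F x \<le> F y"
  using is_cdf by (auto simp: is_cdf_def mono_def)

lemma F_right_cont: "continuous (at_right a) F"
  using is_cdf by (auto simp: is_cdf_def)

lemma F_measurable [measurable]: "F \<in> borel_measurable borel"
  using F_mono by (intro borel_measurable_mono) (auto simp: mono_def)

sublocale value_law: real_distribution value_law
  using is_cdf F_mono by (intro real_distribution_interval_measure) (auto simp: is_cdf_def)

lemma cdf_value_law: "cdf value_law = F"
  using is_cdf F_mono by (intro cdf_interval_measure) (auto simp: is_cdf_def)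

lemma F_ge_0: "0 \<le> F x" and F_le_1: "F x \<le> 1"
  using value_law.cdf_nonneg[of x] value_law.cdf_bounded_prob[of x] by (simp_all add: cdf_value_law)

lemma survival_eq: "1 - F u = measure value_law {u<..}"
proof -
  have "measure value_law (- {..u}) = 1 - measure value_law {..u}"
    using value_law.prob_compl[of "{..u}"] by (simp add: Compl_eq_Diff_UNIV)
  moreover have "- {..u} = {u<..}" by auto
  moreover have "measure value_law {..u} = F u" using cdf_value_law by (simp add: cdf_def fun_eq_iff)
  ultimately show ?thesis by simp
qed

text \<open>By Fubini, the integral of \<open>P(X > u)\<close> over \<open>u \<ge> x\<close> is the expectation of the positive part of
\<open>X - x\<close>.\<close>
lemma survival_tail_integrable: "set_integrable lborel {x..} (\<lambda>u. 1 - F u)"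
  unfolding set_integrable_def
proof (rule integrableI_bounded)
  interpret L: pair_sigma_finite lborel value_law ..
  have "(\<integral>\<^sup>+u. ennreal (norm (indicat_real {x..} u *\<^sub>R (1 - F u))) \<partial>lborel) =
      (\<integral>\<^sup>+u. (\<integral>\<^sup>+y. indicator {x..} u * indicator {u<..} y \<partial>value_law) \<partial>lborel)"
    using F_le_1 by (intro nn_integral_cong)
      (auto simp: nn_integral_cmult survival_eq value_law.emeasure_eq_measure split: split_indicator)
  also have "\<dots> = (\<integral>\<^sup>+y. (\<integral>\<^sup>+u. indicator {x..} u * indicator {u<..} y \<partial>lborel) \<partial>value_law)"
    by (rule L.Fubini'[symmetric]) (measurable, simp)
  also have "\<dots> = (\<integral>\<^sup>+y. ennreal (max (y - x) 0) \<partial>value_law)"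
  proof (intro nn_integral_cong)
    fix y
    have "(\<integral>\<^sup>+u. indicator {x..} u * indicator {u<..} y \<partial>lborel) = (\<integral>\<^sup>+u. indicator {x..<y} u \<partial>lborel)"
      by (intro nn_integral_cong) (auto split: split_indicator)
    also have "\<dots> = ennreal (max (y - x) 0)"
      by (cases "x \<le> y") (auto simp: max_def)
    finally show "(\<integral>\<^sup>+u. indicator {x..} u * indicator {u<..} y \<partial>lborel) = ennreal (max (y - x) 0)" .
  qed
  also have "\<dots> \<le> (\<integral>\<^sup>+y. ennreal (max y 0 + \<bar>x\<bar>) \<partial>value_law)"
    by (intro nn_integral_mono ennreal_leI) auto
  also have "\<dots> < \<infinity>"
    using pos_part_integrable by (subst nn_integral_eq_integral) auto
  finally show "(\<integral>\<^sup>+u. ennreal (norm (indicat_real {x..} u *\<^sub>R (1 - F u))) \<partial>lborel) < \<infinity>" .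
qed measurable

lemma survival_integrable_on: "(\<lambda>u. 1 - F u) integrable_on {x..y}"
  using integrable_on_mono_on[of x y F] F_mono by (intro integrable_diff) (auto simp: mono_on_def)

lemma phi_split:
  assumes "x \<le> y"
  shows "phi F x = integral {x..y} (\<lambda>u. 1 - F u) + phi F y"
proof -
  have si: "set_integrable lborel A (\<lambda>u. 1 - F u)" if "A \<subseteq> {x..}" "A \<in> sets borel" for A
    using that by (intro set_integrable_subset[OF survival_tail_integrable]) auto
  have "{x..} = {x..<y} \<union> {y..}" using assms by auto
  then have "phi F x = (LINT u:{x..<y}|lborel. 1 - F u) + phi F y"
    using assms unfolding phi_def
    by (auto intro!: set_integral_Un si)
  also have "(LINT u:{x..<y}|lborel. 1 - F u) = (LINT u:{x..y}|lborel. 1 - F u)"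
    using AE_lborel_singleton[of y]
    by (intro set_integral_cong_set) (auto intro!: borel_measurable_integrable si[unfolded set_integrable_def] simp: set_borel_measurable_def)
  also have "\<dots> = integral {x..y} (\<lambda>u. 1 - F u)"
    by (intro set_borel_integral_eq_integral si) auto
  finally show ?thesis .
qed

lemma phi_nonneg: "0 \<le> phi F x"
  unfolding phi_def set_lebesgue_integral_def using F_le_1
  by (intro integral_nonneg_AE) auto

lemma phi_antimono: "x \<le> y \<Longrightarrow> phi F y \<le> phi F x"
  using phi_split[of x y] F_le_1 by (auto intro!: integral_nonneg survival_integrable_on)

lemma phi_diff_le:
  assumes "x \<le> y"
  shows "phi F x \<le> (y - x) + phi F y"
proof -
  have "integral {x..y} (\<lambda>u. 1 - F u) \<le> integral {x..y} (\<lambda>u. 1)"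
    using F_ge_0 by (intro integral_le survival_integrable_on) auto
  then show ?thesis using phi_split[OF assms] assms by simp
qed

lemma phi_continuous: "continuous_on A (phi F)"
proof -
  have "1-lipschitz_on UNIV (phi F)"
  proof (rule lipschitz_onI)
    fix x y show "dist (phi F x) (phi F y) \<le> 1 * dist x y"
      using phi_antimono[of x y] phi_antimono[of y x] phi_diff_le[of x y] phi_diff_le[of y x]
      by (cases "x \<le> y") (auto simp: dist_real_def)
  qed auto
  then show ?thesis
    using continuous_on_subset lipschitz_on_continuous_on by blast
qed

lemma phi_right_derivative: "(phi F has_real_derivative - (1 - F x)) (at_right x)"
proof -
  have "((\<lambda>y. phi F x - integral {x..y} (\<lambda>u. 1 - F u)) has_real_derivative - (1 - F x)) (at_right x)"
    using integral_right_derivative[OF survival_integrable_on[of x "x + 1"], of x]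
      continuous_diff[OF continuous_const F_right_cont[of x], of 1]
    by (auto intro!: derivative_eq_intros)
  then have "((\<lambda>y. phi F x - integral {x..y} (\<lambda>u. 1 - F u)) has_real_derivative - (1 - F x)) (at x within {x..x+1})"
    by (simp add: at_within_Icc_at_right)
  then have "(phi F has_real_derivative - (1 - F x)) (at x within {x..x+1})"
    by (rule has_field_derivative_transform_within[OF _ zero_less_one]) (auto simp: phi_split[of x])
  then show ?thesis by (simp add: at_within_Icc_at_right)
qed

lemma phi_pos:
  assumes "ereal x < upper_end F"
  shows "0 < phi F x"
proof -
  obtain y where y: "F y < 1" "x < y"
    using assms by (auto simp: upper_end_def less_SUP_iff)
  have "0 < (1 - F y) * (y - x)" using y by simp
  also have "\<dots> = integral {x..y} (\<lambda>u. 1 - F y)" using y by simp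
  also have "\<dots> \<le> integral {x..y} (\<lambda>u. 1 - F u)"
    by (intro integral_le survival_integrable_on) (auto intro: F_mono)
  also have "\<dots> \<le> phi F x" using phi_split[of x y] phi_nonneg[of y] y by simp
  finally show ?thesis .
qed

text \<open>The integrand \<open>1 - F\<close> is at most \<open>1\<close> and vanishes beyond \<open>M\<close>. This makes \<open>1 / \<phi>\<close> non-integrable
at a finite upper end.\<close>
lemma phi_le_distance_to_upper_end:
  assumes "upper_end F = ereal M" "x < M"
  shows "phi F x \<le> M - x"
proof (rule field_le_epsilon)
  fix e :: real assume "e > 0"
  have "F u = 1" if "u \<ge> M + e" for u
  proof (rule ccontr)
    assume "F u \<noteq> 1"
    then have "F u < 1" using F_le_1[of u] by simp
    then have "ereal u \<le> upper_end F"
      unfolding upper_end_def by (intro SUP_upper) simp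
    then show False using that \<open>e > 0\<close> assms by simp
  qed
  then have "phi F (M + e) = (LINT u:{M+e..}|lborel. 0)"
    unfolding phi_def by (intro set_lebesgue_integral_cong) auto
  then show "phi F x \<le> M - x + e"
    using phi_diff_le[of x "M + e"] assms \<open>e > 0\<close> by (simp add: set_lebesgue_integral_def)
qed

end

section \<open>The optimal policy\<close>

lemma lborel_integral_eq_integral:
  fixes f :: "real \<Rightarrow> real"
  assumes "continuous_on {a..b} f"
  shows "(LINT w:{a..b}|lborel. f w) = integral {a..b} f"
  using borel_integrable_atLeastAtMost'[OF assms] by (rule set_borel_integral_eq_integral(2))

locale sale_problem = offer_distribution F for F +
  fixes lam m :: real
  assumes lam_pos: "lam > 0" and m_less: "ereal m < upper_end F"
begin

abbreviation \<mu> :: "real \<Rightarrow> real" where "\<mu> \<equiv> policy lam F m"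

definition price_range :: "real set" where "price_range = {x. m \<le> x \<and> ereal x < upper_end F}"

lemma m_in_price_range: "m \<in> price_range"
  using m_less by (simp add: price_range_def)

lemma price_range_downward: "y \<in> price_range \<Longrightarrow> m \<le> x \<Longrightarrow> x \<le> y \<Longrightarrow> x \<in> price_range"
  by (auto simp: price_range_def intro: le_less_trans[of "ereal x" "ereal y"])

lemma phi_pos_price_range: "x \<in> price_range \<Longrightarrow> 0 < phi F x"
  by (auto simp: price_range_def intro: phi_pos)

lemma reciprocal_phi_continuous:
  assumes "b \<in> price_range"
  shows "continuous_on {m..b} (\<lambda>x. 1 / phi F x)"
  using assms phi_pos_price_range price_range_downward
  by (intro continuous_intros phi_continuous) (force simp: less_le)

lemma Psi_eq: "x \<in> price_range \<Longrightarrow> Psi F m x = integral {m..x} (\<lambda>u. 1 / phi F u)"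
  unfolding Psi_def by (intro lborel_integral_eq_integral reciprocal_phi_continuous)

lemma Psi_diff:
  assumes "m \<le> x" "x \<le> y" "y \<in> price_range"
  shows "Psi F m y - Psi F m x = integral {x..y} (\<lambda>u. 1 / phi F u)"
    and "(\<lambda>u. 1 / phi F u) integrable_on {x..y}"
proof -
  have int: "(\<lambda>u. 1 / phi F u) integrable_on {m..y}"
    using assms by (intro integrable_continuous_real reciprocal_phi_continuous)
  show "Psi F m y - Psi F m x = integral {x..y} (\<lambda>u. 1 / phi F u)"
    using assms price_range_downward[of y x] Henstock_Kurzweil_Integration.integral_combine[OF assms(1,2) int]
    by (simp add: Psi_eq)
  show "(\<lambda>u. 1 / phi F u) integrable_on {x..y}"
    using int assms by (auto intro: integrable_subinterval_real)
qed

text \<open>As \<open>\<phi>\<close> is decreasing, \<open>1 / \<phi>\<close> lies on \<open>[x, y]\<close> between its values at the end points. Read for the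
inverse function \<open>\<mu>\<close>, these bounds give its continuity and its right derivative.\<close>
lemma Psi_increment_bounds:
  assumes "m \<le> x" "x \<le> y" "y \<in> price_range"
  shows "(y - x) / phi F x \<le> Psi F m y - Psi F m x"
    and "Psi F m y - Psi F m x \<le> (y - x) / phi F y"
proof -
  have *: "0 < phi F u" "phi F u \<le> phi F x" "phi F y \<le> phi F u" if "u \<in> {x..y}" for u
    using that assms price_range_downward[of y u] phi_pos_price_range phi_antimono by auto
  then have 1: "0 < phi F x" "0 < phi F y" using assms by auto
  have "integral {x..y} (\<lambda>u. 1 / phi F x) \<le> integral {x..y} (\<lambda>u. 1 / phi F u)"
    using * 1 by (intro integral_le Psi_diff assms) (auto intro!: frac_le)
  then show "(y - x) / phi F x \<le> Psi F m y - Psi F m x"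
    using assms by (simp add: Psi_diff(1))
  have "integral {x..y} (\<lambda>u. 1 / phi F u) \<le> integral {x..y} (\<lambda>u. 1 / phi F y)"
    using * 1 by (intro integral_le Psi_diff assms) (auto intro!: frac_le)
  then show "Psi F m y - Psi F m x \<le> (y - x) / phi F y"
    using assms by (simp add: Psi_diff(1))
qed

lemma Psi_m: "Psi F m m = 0"
  using m_in_price_range by (simp add: Psi_eq)

lemma Psi_strict_mono: "m \<le> x \<Longrightarrow> x < y \<Longrightarrow> y \<in> price_range \<Longrightarrow> Psi F m x < Psi F m y"
  using Psi_increment_bounds(1)[of x y] phi_pos_price_range[of x] price_range_downward[of y x]
  by (smt (verit) divide_pos_pos)

lemma Psi_inj: "inj_on (Psi F m) price_range"
proof (rule inj_onI)
  fix x y assume "x \<in> price_range" "y \<in> price_range" "Psi F m x = Psi F m y"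
  then show "x = y"
    using Psi_strict_mono[of x y] Psi_strict_mono[of y x] by (cases x y rule: linorder_cases) (auto simp: price_range_def)
qed

text \<open>Integration of \<open>1 / \<phi> u \<ge> 1 / (M - u)\<close>.\<close>
lemma Psi_ge_log:
  assumes "upper_end F = ereal M" "m \<le> x" "x < M"
  shows "ln (M - m) - ln (M - x) \<le> Psi F m x"
proof -
  have x: "x \<in> price_range" using assms by (simp add: price_range_def)
  have "((\<lambda>u. 1 / (M - u)) has_integral (- ln (M - x) - - ln (M - m))) {m..x}"
    using assms by (intro fundamental_theorem_of_calculus)
      (auto simp flip: has_real_derivative_iff_has_vector_derivative intro!: derivative_eq_intros)
  moreover have "((\<lambda>u. 1 / phi F u) has_integral Psi F m x) {m..x}"
    using Psi_diff[of m x] x assms(2) Psi_m by (simp add: has_integral_integral)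
  moreover have "1 / (M - u) \<le> 1 / phi F u" if "u \<in> {m..x}" for u
    using that assms phi_le_distance_to_upper_end[of M u] phi_pos[of u]
    by (intro frac_le) auto
  ultimately have "- ln (M - x) - - ln (M - m) \<le> Psi F m x"
    by (rule has_integral_le)
  then show ?thesis by simp
qed

text \<open>This makes the policy well defined for all times. If the upper end \<open>M\<close> is finite, \<open>Psi\<close> diverges
logarithmically there; if it is infinite, \<open>Psi\<close> grows at least linearly because \<open>\<phi>\<close> is bounded by
\<open>\<phi> m\<close>.\<close>
lemma Psi_unbounded:
  assumes "0 \<le> y"
  shows "\<exists>x\<in>price_range. y \<le> Psi F m x"
proof (cases "upper_end F")
  case (real M)
  \<comment> \<open>the point where the logarithmic lower bound equals \<open>y\<close>\<close>
  define x where "x = M - (M - m) * exp (- y)"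
  have mM: "m < M" using m_less real by simp
  have "(M - m) * exp (- y) \<le> (M - m) * 1" "0 < (M - m) * exp (- y)"
    using mM assms by (intro mult_left_mono mult_pos_pos; simp)+
  then have x: "m \<le> x" "x < M" by (auto simp: x_def)
  have "ln (M - x) = ln (M - m) - y"
    using mM by (simp add: x_def ln_mult)
  then show ?thesis using Psi_ge_log[OF real x] real x by (auto simp: price_range_def)
next
  case PInf
  define x where "x = m + y * phi F m"
  have "x \<in> price_range" "m \<le> x" using PInf phi_nonneg[of m] assms by (auto simp: x_def price_range_def)
  moreover have "(x - m) / phi F m = y" using phi_pos_price_range[OF m_in_price_range] by (simp add: x_def)
  ultimately show ?thesis using Psi_increment_bounds(1)[of m x] Psi_m by auto
qed (use m_less in auto)

lemma Psi_surj:
  assumes "0 \<le> y"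
  shows "\<exists>x\<in>price_range. Psi F m x = y"
proof -
  obtain b where b: "b \<in> price_range" "y \<le> Psi F m b" using Psi_unbounded[OF assms] by auto
  then have "m \<le> b" by (simp add: price_range_def)
  have "continuous_on {m..b} (\<lambda>x. integral {m..x} (\<lambda>u. 1 / phi F u))"
    using b by (intro indefinite_integral_continuous_1 integrable_continuous_real reciprocal_phi_continuous)
  then have "continuous_on {m..b} (Psi F m)"
    using b price_range_downward by (subst continuous_on_cong[OF refl Psi_eq]) auto
  then obtain x where "m \<le> x" "x \<le> b" "Psi F m x = y"
    using IVT'[of "Psi F m" m y b] b \<open>m \<le> b\<close> assms Psi_m by auto
  then show ?thesis using b price_range_downward by auto
qed

lemma policy_in_price_range: "0 \<le> t \<Longrightarrow> \<mu> t \<in> price_range" and Psi_policy: "0 \<le> t \<Longrightarrow> Psi F m (\<mu> t) = lam * t"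
proof -
  assume "0 \<le> t"
  then have "lam * t \<in> Psi F m ` price_range" using Psi_surj[of "lam * t"] lam_pos by force
  then show "\<mu> t \<in> price_range" "Psi F m (\<mu> t) = lam * t"
    using the_inv_into_into[OF Psi_inj _ order_refl] f_the_inv_into_f[OF Psi_inj]
    by (auto simp: policy_def price_range_def)
qed

lemma m_le_policy: "0 \<le> t \<Longrightarrow> m \<le> \<mu> t"
  using policy_in_price_range by (simp add: price_range_def)

lemma phi_policy_pos: "0 \<le> t \<Longrightarrow> 0 < phi F (\<mu> t)"
  by (intro phi_pos_price_range policy_in_price_range)

lemma policy_0: "\<mu> 0 = m"
  using inj_onD[OF Psi_inj, of "\<mu> 0" m] policy_in_price_range[of 0] Psi_policy[of 0] m_in_price_range Psi_m by simp

lemma policy_strict_mono: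
  assumes "0 \<le> s" "s < t"
  shows "\<mu> s < \<mu> t"
proof (rule ccontr)
  assume "\<not> \<mu> s < \<mu> t"
  then have "\<mu> t < \<mu> s \<or> \<mu> t = \<mu> s" by auto
  then have "Psi F m (\<mu> t) \<le> Psi F m (\<mu> s)"
    using Psi_strict_mono[of "\<mu> t" "\<mu> s"] policy_in_price_range[of s] m_le_policy[of t] assms by auto
  then show False using assms lam_pos by (simp add: Psi_policy)
qed

lemma policy_mono: "0 \<le> s \<Longrightarrow> s \<le> t \<Longrightarrow> \<mu> s \<le> \<mu> t"
  using policy_strict_mono[of s t] by (cases "s = t") auto

lemma policy_increment_bounds:
  assumes "0 \<le> s" "s \<le> t"
  shows "phi F (\<mu> t) * (lam * (t - s)) \<le> \<mu> t - \<mu> s"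
    and "\<mu> t - \<mu> s \<le> phi F (\<mu> s) * (lam * (t - s))"
  using Psi_increment_bounds[of "\<mu> s" "\<mu> t"] assms policy_mono[of s t] m_le_policy[of s]
    policy_in_price_range[of t] phi_policy_pos[of s] phi_policy_pos[of t]
  by (auto simp: Psi_policy field_simps)

lemma policy_continuous: "continuous_on {0..} \<mu>"
proof -
  have "(lam * phi F m)-lipschitz_on {0..} \<mu>"
  proof (rule lipschitz_onI)
    have *: "\<bar>\<mu> t - \<mu> s\<bar> \<le> lam * phi F m * (t - s)" if "0 \<le> s" "s \<le> t" for s t
    proof -
      have "\<mu> t - \<mu> s \<le> phi F (\<mu> s) * (lam * (t - s))"
        using policy_increment_bounds(2)[OF that] .
      also have "\<dots> \<le> phi F m * (lam * (t - s))"
        using that lam_pos m_le_policy[of s] by (intro mult_right_mono phi_antimono) auto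
      finally show ?thesis using policy_mono[OF that] by (simp add: ac_simps)
    qed
    show "dist (\<mu> s) (\<mu> t) \<le> lam * phi F m * dist s t" if "s \<in> {0..}" "t \<in> {0..}" for s t
      using *[of s t] *[of t s] that by (cases "s \<le> t") (auto simp: dist_real_def)
  qed (use lam_pos phi_nonneg in auto)
  then show ?thesis by (rule lipschitz_on_continuous_on)
qed

lemma policy_tendsto_right:
  assumes "0 \<le> t"
  shows "(\<mu> \<longlongrightarrow> \<mu> t) (at_right t)"
proof -
  have "(\<mu> \<longlongrightarrow> \<mu> t) (at t within {0..})"
    using policy_continuous assms by (auto simp: continuous_on_def)
  then show ?thesis by (rule tendsto_within_subset) (use assms in auto)
qed

text \<open>The difference quotient lies between \<open>\<lambda> \<phi> (\<mu> y)\<close> and \<open>\<lambda> \<phi> (\<mu> t)\<close>, and the former tends to the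
latter.\<close>
lemma policy_right_derivative:
  assumes "0 \<le> t"
  shows "(\<mu> has_real_derivative lam * phi F (\<mu> t)) (at_right t)"
  unfolding has_field_derivative_iff
proof (rule tendsto_sandwich)
  have "isCont (phi F) (\<mu> t)" using phi_continuous[of UNIV] by (simp add: continuous_on_eq_continuous_at)
  then have "((\<lambda>y. phi F (\<mu> y)) \<longlongrightarrow> phi F (\<mu> t)) (at_right t)"
    using policy_tendsto_right[OF assms] by (rule isCont_tendsto_compose)
  then show "((\<lambda>y. lam * phi F (\<mu> y)) \<longlongrightarrow> lam * phi F (\<mu> t)) (at_right t)"
    by (intro tendsto_intros)
  show "\<forall>\<^sub>F y in at_right t. lam * phi F (\<mu> y) \<le> (\<mu> y - \<mu> t) / (y - t)"
    using eventually_at_right_less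
    by eventually_elim (use policy_increment_bounds(1)[of t] assms in \<open>auto simp: field_simps\<close>)
  show "\<forall>\<^sub>F y in at_right t. (\<mu> y - \<mu> t) / (y - t) \<le> lam * phi F (\<mu> t)"
    using eventually_at_right_less
    by eventually_elim (use policy_increment_bounds(2)[of t] assms in \<open>auto simp: field_simps\<close>)
qed simp

text \<open>The chain rule holds for right derivatives because the inner function \<open>\<mu>\<close> is strictly
increasing: points to the right of \<open>t\<close> go to points to the right of \<open>\<mu> t\<close>.\<close>
lemma right_derivative_compose_policy:
  assumes "0 \<le> t" "(f has_real_derivative D) (at_right (\<mu> t))"
  shows "((\<lambda>s. f (\<mu> s)) has_real_derivative D * (lam * phi F (\<mu> t))) (at_right t)"
proof -
  have "(f has_real_derivative D) (at (\<mu> t) within \<mu> ` {t<..})"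
    using assms(2) by (rule DERIV_subset) (use policy_strict_mono assms in auto)
  from DERIV_image_chain[OF this policy_right_derivative[OF assms(1)]]
  show ?thesis by (simp add: o_def)
qed

lemma phi_policy_right_derivative:
  "0 \<le> t \<Longrightarrow> ((\<lambda>s. phi F (\<mu> s)) has_real_derivative - (1 - F (\<mu> t)) * (lam * phi F (\<mu> t))) (at_right t)"
  by (intro right_derivative_compose_policy phi_right_derivative)

lemma phi_policy_continuous: "continuous_on {0..} (\<lambda>t. phi F (\<mu> t))"
  by (intro continuous_on_compose2[OF phi_continuous policy_continuous]) auto

lemma F_policy_right_continuous:
  assumes "0 \<le> t"
  shows "continuous (at_right t) (\<lambda>s. F (\<mu> s))"
proof -
  have "\<forall>\<^sub>F s in at_right t. \<mu> t < \<mu> s"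
    using eventually_at_right_less[of t] by eventually_elim (rule policy_strict_mono[OF assms])
  then have "filterlim \<mu> (at_right (\<mu> t)) (at_right t)"
    using policy_tendsto_right[OF assms] by (auto simp: filterlim_at elim: eventually_mono)
  then show ?thesis
    using F_right_cont[of "\<mu> t"] unfolding continuous_within by (rule filterlim_compose[rotated])
qed

end

section \<open>Sample paths of the bidding process\<close>

text \<open>Seen from the first offer on, the process is a process again, driven by the shifted sequences
\<open>d'\<close> and \<open>x'\<close> and started with the time that is left.\<close>
lemma remaining_tail:
  assumes "\<And>i. i \<ge> 1 \<Longrightarrow> d' i = d (Suc i)"
  shows "remaining d t (Suc i) = remaining d' (max (t - d 1) 0) i"
  by (induction i) (use assms in auto)

lemma remaining_bounds:
  assumes "\<And>i. i \<ge> 1 \<Longrightarrow> 0 \<le> d i" "0 \<le> t"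
  shows "0 \<le> remaining d t i" "remaining d t i \<le> t"
proof (induction i)
  case (Suc i)
  { case 1 show ?case by simp next
    case 2 show ?case using Suc assms(1)[of "Suc i"] assms(2) by simp }
qed (use assms in auto)

lemma accepted_tail:
  assumes "\<And>i. i \<ge> 1 \<Longrightarrow> d' i = d (Suc i)" "\<And>i. i \<ge> 1 \<Longrightarrow> x' i = x (Suc i)"
  shows "accepted pol d x t (Suc i) \<longleftrightarrow>
    (if i = 0 then d 1 < t \<and> pol (t - d 1) \<le> x 1 else accepted pol d' x' (max (t - d 1) 0) i)"
proof (cases i)
  case (Suc j)
  then show ?thesis
    using remaining_tail[of d' d t i, OF assms(1)] assms(2)[of i] by (simp add: accepted_def del: remaining.simps)
qed (auto simp: accepted_def max_def)

lemma not_accepted_0: "\<not> accepted pol d x t 0"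
  by (simp add: accepted_def)

lemma time_to_sale_bounds:
  assumes "\<And>i. i \<ge> 1 \<Longrightarrow> 0 \<le> d i" "0 \<le> t"
  shows "0 \<le> time_to_sale pol d x t" "time_to_sale pol d x t \<le> t"
  using remaining_bounds[OF assms] assms(2) by (auto simp: time_to_sale_def)

text \<open>The delays must be nonnegative: a negative delay after the deadline would bring back positive
remaining time, and a later offer could still be accepted.\<close>
lemma time_to_sale_first_offer:
  assumes d: "\<And>i. i \<ge> 1 \<Longrightarrow> 0 \<le> d i"
    and tail: "\<And>i. i \<ge> 1 \<Longrightarrow> d' i = d (Suc i)" "\<And>i. i \<ge> 1 \<Longrightarrow> x' i = x (Suc i)"
  shows "time_to_sale pol d x t =
    (if t \<le> d 1 then t else if pol (t - d 1) \<le> x 1 then d 1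
     else d 1 + time_to_sale pol d' x' (t - d 1))"
proof -
  let ?a = "accepted pol d x t"
  note a = accepted_tail[of d' d x' x pol t, OF tail]
  consider "t \<le> d 1" | "d 1 < t" "pol (t - d 1) \<le> x 1" | "d 1 < t" "\<not> pol (t - d 1) \<le> x 1"
    by linarith
  then show ?thesis
  proof cases
    case 1
    have "remaining d' 0 i = 0" for i
      using remaining_bounds[of d' 0 i] d tail(1) by force
    then have "\<not> accepted pol d' x' 0 i" for i by (simp add: accepted_def)
    then have "\<not> ?a i" for i
      using 1 a not_accepted_0 by (cases i) auto
    then show ?thesis using 1 by (simp add: time_to_sale_def)
  next
    case 2
    then have "?a 1" using a[of 0] by simp
    moreover have "(LEAST i. ?a i) = 1"
      using \<open>?a 1\<close> by (intro Least_equality) (auto simp: accepted_def)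
    ultimately show ?thesis using 2 by (auto simp: time_to_sale_def)
  next
    case 3
    then have *: "?a (Suc i) \<longleftrightarrow> accepted pol d' x' (t - d 1) i" for i
      using a[of i] by (cases i) (auto simp: accepted_def)
    show ?thesis
    proof (cases "\<exists>i. ?a i")
      case True
      then obtain i where "?a i" by auto
      then have "(LEAST i. ?a i) = Suc (LEAST i. ?a (Suc i))"
        by (intro Least_Suc not_accepted_0)
      moreover have "\<exists>i. accepted pol d' x' (t - d 1) i"
        using \<open>?a i\<close> * not_accepted_0 by (cases i) auto
      ultimately show ?thesis
        using 3 True * remaining_tail[of d' d t, OF tail(1)]
        by (simp add: time_to_sale_def max_def del: remaining.simps)
    next
      case False
      then show ?thesis using 3 * by (auto simp: time_to_sale_def)
    qed
  qed
qed

text \<open>Offers at remaining time \<open>0\<close> are never accepted, so only the values of the policy on the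
positive half line enter. Measurability can thus be checked for \<open>\<lambda>r. \<mu> (max r 0)\<close>, which is
continuous on the whole line.\<close>
lemma time_to_sale_cong_policy:
  assumes "\<And>r. 0 < r \<Longrightarrow> pol r = pol' r"
  shows "time_to_sale pol d x t = time_to_sale pol' d x t"
proof -
  have "accepted pol d x t = accepted pol' d x t"
    using assms by (auto simp: accepted_def fun_eq_iff)
  then show ?thesis by (simp add: time_to_sale_def)
qed

lemma measurable_time_to_sale [measurable (raw)]:
  assumes [measurable]: "pol \<in> borel_measurable borel" "t \<in> borel_measurable M"
    "\<And>i. d i \<in> borel_measurable M" "\<And>i. x i \<in> borel_measurable M"
  shows "(\<lambda>\<omega>. time_to_sale pol (\<lambda>i. d i \<omega>) (\<lambda>i. x i \<omega>) (t \<omega>)) \<in> borel_measurable M"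
proof -
  have [measurable]: "(\<lambda>\<omega>. remaining (\<lambda>i. d i \<omega>) (t \<omega>) i) \<in> borel_measurable M" for i
    by (induction i) simp_all
  have [measurable]: "Measurable.pred M (\<lambda>\<omega>. accepted pol (\<lambda>i. d i \<omega>) (\<lambda>i. x i \<omega>) (t \<omega>) i)" for i
    unfolding accepted_def by measurable
  have [measurable]: "(\<lambda>\<omega>. LEAST i. accepted pol (\<lambda>i. d i \<omega>) (\<lambda>i. x i \<omega>) (t \<omega>) i)
      \<in> measurable M (count_space UNIV)"
    by measurable
  have [measurable]: "(\<lambda>\<omega>. remaining (\<lambda>i. d i \<omega>) (t \<omega>)
      (LEAST i. accepted pol (\<lambda>i. d i \<omega>) (\<lambda>i. x i \<omega>) (t \<omega>) i)) \<in> borel_measurable M"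
    by (rule measurable_compose_countable) measurable
  show ?thesis unfolding time_to_sale_def by measurable
qed

section \<open>The renewal equation\<close>

lemma abs_convex_combination_le:
  fixes a b p B :: real
  assumes "0 \<le> p" "p \<le> 1" "\<bar>a\<bar> \<le> B" "\<bar>b\<bar> \<le> B"
  shows "\<bar>(1 - p) * a + p * b\<bar> \<le> B"
proof -
  have "\<bar>(1 - p) * a + p * b\<bar> \<le> (1 - p) * \<bar>a\<bar> + p * \<bar>b\<bar>"
    using assms by (intro order.trans[OF abs_triangle_ineq]) (simp add: abs_mult)
  also have "\<dots> \<le> (1 - p) * B + p * B"
    using assms by (intro add_mono mult_left_mono) auto
  finally show ?thesis by (simp add: algebra_simps)
qed

context sale_problem
begin

text \<open>A sample path becomes a sequence \<open>\<omega>\<close> of independent pairs of a delay and a value, where \<open>\<omega> n\<close>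
belongs to the offer with number \<open>n + 1\<close>.\<close>
abbreviation delay_law :: "real measure" where "delay_law \<equiv> density lborel (exponential_density lam)"

sublocale delay_law: prob_space delay_law
  by (rule prob_space_exponential_density[OF lam_pos])

sublocale offer: pair_prob_space delay_law value_law ..

abbreviation offer_law :: "(real \<times> real) measure" where "offer_law \<equiv> delay_law \<Otimes>\<^sub>M value_law"

sublocale seq: sequence_space offer_law ..

abbreviation paths :: "(nat \<Rightarrow> real \<times> real) measure" where
  "paths \<equiv> \<Pi>\<^sub>M i\<in>UNIV. offer_law"

definition time_left :: "real \<Rightarrow> (nat \<Rightarrow> real \<times> real) \<Rightarrow> real" where
  "time_left t \<omega> = t - time_to_sale \<mu> (\<lambda>i. fst (\<omega> (i - 1))) (\<lambda>i. snd (\<omega> (i - 1))) t"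

lemma policy_max_measurable [measurable]: "(\<lambda>r. \<mu> (max r 0)) \<in> borel_measurable borel"
  by (intro borel_measurable_continuous_onI continuous_on_compose2[OF policy_continuous] continuous_intros) auto

lemma time_left_measurable [measurable (raw)]:
  assumes [measurable]: "t \<in> borel_measurable M" "w \<in> measurable M paths"
  shows "(\<lambda>z. time_left (t z) (w z)) \<in> borel_measurable M"
proof -
  have [measurable]: "(\<lambda>z. w z i) \<in> measurable M offer_law" for i
    by (rule measurable_compose[OF assms(2)]) simp
  have [measurable]: "(\<lambda>z. fst (w z i)) \<in> borel_measurable M" "(\<lambda>z. snd (w z i)) \<in> borel_measurable M" for i
    by (auto intro!: measurable_compose[OF \<open>(\<lambda>z. w z i) \<in> measurable M offer_law\<close>]
        simp: measurable_cong_sets[of _ _ lborel borel])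
  have "time_left (t z) (w z) =
      t z - time_to_sale (\<lambda>r. \<mu> (max r 0)) (\<lambda>i. fst (w z (i - 1))) (\<lambda>i. snd (w z (i - 1))) (t z)" for z
    unfolding time_left_def
    by (intro arg_cong2[where f = "(-)"] refl time_to_sale_cong_policy) (simp add: max_def)
  then show ?thesis by simp
qed

lemma AE_delay_nonneg: "AE s in offer_law. 0 \<le> fst s"
proof (rule offer.AE_pair_measure)
  show "AE x in delay_law. AE y in value_law. 0 \<le> fst (x, y)"
    by (auto simp: AE_density exponential_density_def intro!: AE_I2)
qed measurable

lemma AE_delays_nonneg: "AE \<omega> in paths. \<forall>i. 0 \<le> fst (\<omega> i)"
  unfolding AE_all_countable
  by (intro allI AE_PiM_component[where P = "\<lambda>s. 0 \<le> fst s"] AE_delay_nonneg offer.prob_space_axioms) auto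

lemma AE_time_left_bounds:
  assumes "0 \<le> t"
  shows "AE \<omega> in paths. time_left t \<omega> \<in> {0..t}"
  using AE_delays_nonneg
proof eventually_elim
  case (elim \<omega>)
  then show ?case
    using time_to_sale_bounds[of "\<lambda>i. fst (\<omega> (i - 1))" t \<mu>] assms by (simp add: time_left_def)
qed

lemma time_left_first_offer:
  assumes "0 \<le> fst s" "\<And>i. 0 \<le> fst (\<omega> i)"
  shows "time_left t (case_nat s \<omega>) =
    (if t \<le> fst s then 0 else if \<mu> (max (t - fst s) 0) \<le> snd s then t - fst s
     else time_left (t - fst s) \<omega>)"
proof -
  let ?w = "case_nat s \<omega>"
  have "0 \<le> fst (?w (i - 1))" for i using assms by (auto split: nat.split)
  then show ?thesis
    unfolding time_left_def
    by (subst time_to_sale_first_offer[where d' = "\<lambda>i. fst (\<omega> (i - 1))" and x' = "\<lambda>i. snd (\<omega> (i - 1))"])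
      (auto simp: max_def split: nat.split)
qed

definition expected :: "(real \<Rightarrow> real) \<Rightarrow> real \<Rightarrow> real" where
  "expected K t = (\<integral>\<omega>. K (time_left t \<omega>) \<partial>paths)"

lemma expected_measurable [measurable]:
  assumes [measurable]: "K \<in> borel_measurable borel"
  shows "expected K \<in> borel_measurable borel"
  unfolding expected_def by measurable

lemma countable_policy_atoms: "countable {r. 0 \<le> r \<and> measure value_law {\<mu> r} \<noteq> 0}"
proof -
  have "inj_on \<mu> {r. 0 \<le> r \<and> measure value_law {\<mu> r} \<noteq> 0}"
    by (rule inj_onI) (metis (mono_tags, lifting) linorder_cases mem_Collect_eq order_less_irrefl policy_strict_mono)
  moreover have "countable (\<mu> ` {r. 0 \<le> r \<and> measure value_law {\<mu> r} \<noteq> 0})"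
    by (rule countable_subset[OF _ value_law.countable_support]) auto
  ultimately show ?thesis using countable_image_inj_on by blast
qed

text \<open>An offer is rejected if it is strictly below the threshold, which has probability \<open>F (\<mu> r-)\<close>. This
differs from \<open>F (\<mu> r)\<close> only if \<open>\<mu> r\<close> is an atom, and the strictly increasing \<open>\<mu>\<close> takes each of
the countably many atoms as a value at most once.\<close>
lemma AE_rejection_probability:
  "AE r in lborel. 0 \<le> r \<longrightarrow> measure value_law {..<\<mu> r} = F (\<mu> r)"
proof -
  have "AE r in lborel. r \<notin> {r. 0 \<le> r \<and> measure value_law {\<mu> r} \<noteq> 0}"
    by (intro AE_not_in countable_imp_null_set_lborel countable_policy_atoms)
  then show ?thesis
  proof eventually_elim
    case (elim r)
    have "measure value_law {..\<mu> r} = measure value_law {..<\<mu> r} + measure value_law {\<mu> r}"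
      unfolding ivl_disj_un(2)[symmetric] by (subst value_law.finite_measure_Union) auto
    moreover have "measure value_law {..\<mu> r} = F (\<mu> r)" using cdf_value_law by (simp add: cdf_def fun_eq_iff)
    ultimately show ?case using elim by auto
  qed
qed

lemma delay_law_tail:
  assumes "0 \<le> t"
  shows "measure delay_law {t..} = exp (- lam * t)"
proof -
  have "distributed delay_law lborel (\<lambda>x. x) (exponential_density lam)"
    using lam_pos by (auto simp: distributed_def distr_id2)
  then have "measure delay_law {t<..} = exp (- lam * t)"
    using delay_law.exponential_distributedD_gt[of "\<lambda>x. x" lam t] assms lam_pos
    by (simp add: greaterThan_def ac_simps)
  moreover have "measure delay_law {t..} = measure delay_law {t<..}"
    using AE_lborel_singleton[of t] by (intro delay_law.finite_measure_eq_AE) (auto simp: AE_density)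
  ultimately show ?thesis by simp
qed

context
  fixes K :: "real \<Rightarrow> real" and t0 B :: real
  assumes K_measurable [measurable]: "K \<in> borel_measurable borel"
    and K_bounded: "\<And>r. r \<in> {0..t0} \<Longrightarrow> \<bar>K r\<bar> \<le> B"
begin

lemma AE_K_time_left_bounded:
  assumes "t \<in> {0..t0}"
  shows "AE \<omega> in paths. \<bar>K (time_left t \<omega>)\<bar> \<le> B"
  using AE_time_left_bounds[of t, OF atLeastAtMost_iff[THEN iffD1, OF assms, THEN conjunct1]]
  by eventually_elim (use assms in \<open>auto intro!: K_bounded\<close>)

lemma integrable_K_time_left:
  assumes "t \<in> {0..t0}"
  shows "integrable paths (\<lambda>\<omega>. K (time_left t \<omega>))"
proof (rule seq.P.integrable_const_bound[where B = B])
  show "AE \<omega> in paths. norm (K (time_left t \<omega>)) \<le> B"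
    using AE_K_time_left_bounded[OF assms] by simp
qed measurable

lemma expected_bounded:
  assumes "t \<in> {0..t0}"
  shows "\<bar>expected K t\<bar> \<le> B"
proof -
  have "\<bar>expected K t\<bar> \<le> (\<integral>\<omega>. \<bar>K (time_left t \<omega>)\<bar> \<partial>paths)"
    unfolding expected_def by (rule integral_abs_bound)
  also have "\<dots> \<le> B"
  proof (rule seq.P.integral_le_const)
    show "AE \<omega> in paths. \<bar>K (time_left t \<omega>)\<bar> \<le> B"
      using AE_K_time_left_bounded[OF assms] by simp
  qed (use integrable_K_time_left[OF assms] in auto)
  finally show ?thesis .
qed

text \<open>Prepending an independent pair to a random sequence does not change its law, so the first pair can
be integrated separately; given this pair, a rejected first offer leaves a fresh process with the
time \<open>t - fst s\<close>.\<close>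
lemma expected_first_offer:
  assumes "t \<in> {0..t0}"
  shows "expected K t = (\<integral>s. (if t \<le> fst s then K 0
      else if \<mu> (max (t - fst s) 0) \<le> snd s then K (t - fst s) else expected K (t - fst s)) \<partial>offer_law)"
proof -
  interpret P: pair_sigma_finite offer_law paths ..
  let ?c = "\<lambda>(s, \<omega>). case_nat s \<omega> :: nat \<Rightarrow> real \<times> real"
  have [measurable]: "?c \<in> measurable (offer_law \<Otimes>\<^sub>M paths) paths"
    by measurable
  have int: "integrable (offer_law \<Otimes>\<^sub>M paths) (\<lambda>z. K (time_left t (?c z)))"
    using integrable_K_time_left[OF assms]
    by (subst (asm) seq.PiM_iter[symmetric]) (simp add: integrable_distr_eq)
  have "expected K t = (\<integral>z. K (time_left t (?c z)) \<partial>(offer_law \<Otimes>\<^sub>M paths))"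
    unfolding expected_def by (subst seq.PiM_iter[symmetric]) (simp add: integral_distr)
  also have "\<dots> = (\<integral>s. \<integral>\<omega>. K (time_left t (case_nat s \<omega>)) \<partial>paths \<partial>offer_law)"
    using P.integral_fst'[OF int] by simp
  also have "\<dots> = (\<integral>s. (if t \<le> fst s then K 0
      else if \<mu> (max (t - fst s) 0) \<le> snd s then K (t - fst s) else expected K (t - fst s)) \<partial>offer_law)"
  proof (rule integral_cong_AE)
    show "AE s in offer_law. (\<integral>\<omega>. K (time_left t (case_nat s \<omega>)) \<partial>paths) =
       (if t \<le> fst s then K 0
        else if \<mu> (max (t - fst s) 0) \<le> snd s then K (t - fst s) else expected K (t - fst s))"
      using AE_delay_nonneg
    proof eventually_elim
      case (elim s)
      have [measurable]: "case_nat s \<in> measurable paths paths"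
        using measurable_compose[OF measurable_Pair1' \<open>?c \<in> _\<close>, of s] by (simp add: space_pair_measure)
      have "(\<integral>\<omega>. K (time_left t (case_nat s \<omega>)) \<partial>paths) =
        (\<integral>\<omega>. K (if t \<le> fst s then 0 else if \<mu> (max (t - fst s) 0) \<le> snd s then t - fst s
          else time_left (t - fst s) \<omega>) \<partial>paths)"
        using AE_delays_nonneg
        by (intro integral_cong_AE) (auto simp: time_left_first_offer elim elim!: eventually_mono)
      then show ?case by (simp add: expected_def seq.P.prob_space)
    qed
  qed measurable
  finally show ?thesis .
qed

text \<open>The maximum with \<open>0\<close> makes the integrand measurable on the whole line; only arguments \<open>r \<ge> 0\<close>
are integrated over.\<close>
abbreviation renewal_integrand :: "real \<Rightarrow> real" where
  "renewal_integrand r \<equiv>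
     lam * exp (lam * r) * ((1 - F (\<mu> (max r 0))) * K r + F (\<mu> (max r 0)) * expected K r)"

lemma renewal_integrand_set_integrable:
  "set_integrable lborel {0..t0} renewal_integrand"
  unfolding set_integrable_def
proof (rule integrableI_bounded_set_indicator[where B = "lam * exp (lam * t0) * B"])
  show "AE r in lborel. r \<in> {0..t0} \<longrightarrow> norm (renewal_integrand r) \<le> lam * exp (lam * t0) * B"
  proof (intro AE_I2 impI)
    fix r assume r: "r \<in> {0..t0}"
    then have "\<bar>(1 - F (\<mu> (max r 0))) * K r + F (\<mu> (max r 0)) * expected K r\<bar> \<le> B"
      using F_ge_0 F_le_1 K_bounded expected_bounded by (intro abs_convex_combination_le) auto
    then have "lam * exp (lam * r) * \<bar>(1 - F (\<mu> (max r 0))) * K r + F (\<mu> (max r 0)) * expected K r\<bar>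
        \<le> lam * exp (lam * t0) * B"
      using r lam_pos by (intro mult_mono) auto
    then show "norm (renewal_integrand r) \<le> lam * exp (lam * t0) * B"
      using lam_pos by (simp add: abs_mult)
  qed
qed (auto simp: emeasure_lborel_Icc_eq)

text \<open>The first delay \<open>d\<close> has the density \<open>\<lambda> exp (- \<lambda> d)\<close>. If it is at least \<open>t\<close>, no time is left, which
gives \<open>exp (- \<lambda> t) K 0\<close>. Otherwise the offer arrives at remaining time \<open>r = t - d\<close>, and it is accepted
or rejected with probabilities \<open>1 - q r\<close> and \<open>q r\<close>. The substitution of \<open>r\<close> for \<open>d\<close> turns the density into
\<open>exp (- \<lambda> t)\<close> times \<open>\<lambda> exp (\<lambda> r)\<close>, which frees the integrand from \<open>t\<close>.\<close>
lemma expected_renewal: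
  assumes t: "t \<in> {0..t0}"
  shows "exp (lam * t) * expected K t = K 0 + integral {0..t} renewal_integrand"
proof -
  define q where "q r = measure value_law {..<\<mu> (max r 0)}" for r
  define H where "H r = (1 - q r) * K r + q r * expected K r" for r
  have q: "0 \<le> q r" "q r \<le> 1" for r by (auto simp: q_def)
  have [measurable]: "q \<in> borel_measurable borel"
  proof -
    have "(\<lambda>r. measure value_law {x. x < \<mu> (max r 0)}) \<in> borel_measurable borel"
      by measurable
    then show ?thesis by (simp add: q_def[abs_def] lessThan_def)
  qed
  have [measurable]: "H \<in> borel_measurable borel" unfolding H_def by measurable
  have H: "\<bar>H r\<bar> \<le> B" if "r \<in> {0..t0}" for r
    unfolding H_def using that q K_bounded expected_bounded by (intro abs_convex_combination_le) auto
  let ?g = "\<lambda>s. if t \<le> fst s then K 0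
      else if \<mu> (max (t - fst s) 0) \<le> snd s then K (t - fst s) else expected K (t - fst s)"
  have int: "integrable offer_law ?g"
  proof (rule offer.integrable_const_bound[where B = B])
    show "AE s in offer_law. norm (?g s) \<le> B"
      using AE_delay_nonneg by eventually_elim (use t in \<open>auto intro!: K_bounded expected_bounded\<close>)
  qed measurable
  have "expected K t = (\<integral>s. ?g s \<partial>offer_law)" by (rule expected_first_offer[OF t])
  also have "\<dots> = (\<integral>d. \<integral>x. ?g (d, x) \<partial>value_law \<partial>delay_law)" by (rule offer.integral_fst'[OF int, symmetric])
  also have "\<dots> = (\<integral>d. indicator {t..} d * K 0 + indicator {..<t} d * H (t - d) \<partial>delay_law)"
  proof (intro Bochner_Integration.integral_cong refl)
    fix d
    show "(\<integral>x. ?g (d, x) \<partial>value_law) = indicator {t..} d * K 0 + indicator {..<t} d * H (t - d)"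
    proof (cases "t \<le> d")
      case False
      have "(\<integral>x. ?g (d, x) \<partial>value_law) = (\<integral>x. K (t - d) + (expected K (t - d) - K (t - d)) * indicator {..<\<mu> (max (t - d) 0)} x \<partial>value_law)"
        using False by (intro Bochner_Integration.integral_cong refl) (auto split: split_indicator)
      also have "\<dots> = H (t - d)"
        using value_law.prob_space by (simp add: H_def q_def value_law.emeasure_eq_measure algebra_simps)
      finally show ?thesis using False by simp
    qed (use value_law.prob_space in simp)
  qed
  also have "\<dots> = (\<integral>d. indicator {t..} d * K 0 \<partial>delay_law) + (\<integral>d. indicator {..<t} d * H (t - d) \<partial>delay_law)"
  proof (rule Bochner_Integration.integral_add)
    show "integrable delay_law (\<lambda>d. indicator {..<t} d * H (t - d))"
    proof (rule delay_law.integrable_const_bound[where B = "\<bar>B\<bar>"])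
      show "AE d in delay_law. norm (indicator {..<t} d * H (t - d)) \<le> \<bar>B\<bar>"
        using t by (auto simp: AE_density exponential_density_def split: split_indicator
          intro!: AE_I2 order.trans[OF H])
    qed measurable
    show "integrable delay_law (\<lambda>d. indicator {t..} d * K 0)" by (simp add: delay_law.emeasure_eq_measure)
  qed
  also have "(\<integral>d. indicator {t..} d * K 0 \<partial>delay_law) = exp (- lam * t) * K 0"
    using t delay_law_tail[of t] by simp
  also have "(\<integral>d. indicator {..<t} d * H (t - d) \<partial>delay_law) =
      (\<integral>d. exponential_density lam d * (indicator {..<t} d * H (t - d)) \<partial>lborel)"
    using lam_pos by (subst integral_density) (auto simp: exponential_density_def)
  also have "\<dots> = (\<integral>r. exponential_density lam (t - r) * (indicator {..<t} (t - r) * H r) \<partial>lborel)"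
    by (subst lborel_integral_real_affine[of "-1" _ t]) auto
  also have "\<dots> = (\<integral>r. exp (- lam * t) * (indicator {0..t} r *\<^sub>R renewal_integrand r) \<partial>lborel)"
  proof (rule integral_cong_AE)
    show "AE r in lborel. exponential_density lam (t - r) * (indicator {..<t} (t - r) * H r) =
        exp (- lam * t) * (indicator {0..t} r *\<^sub>R renewal_integrand r)"
      using AE_rejection_probability AE_lborel_singleton[of 0]
    proof eventually_elim
      case (elim r)
      have "exp ((r - t) * lam) = exp (- lam * t) * exp (lam * r)"
        by (simp flip: exp_add add: algebra_simps)
      then show ?case
        using elim by (auto simp: exponential_density_def H_def q_def max_def split: split_indicator)
    qed
  qed measurable
  also have "\<dots> = exp (- lam * t) * (LINT r:{0..t}|lborel. renewal_integrand r)"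
    by (simp add: set_lebesgue_integral_def)
  also have "(LINT r:{0..t}|lborel. renewal_integrand r) = integral {0..t} renewal_integrand"
    using t by (intro set_borel_integral_eq_integral set_integrable_subset[OF renewal_integrand_set_integrable]) auto
  finally show ?thesis by (simp add: exp_minus field_simps)
qed

lemma renewal_integrand_integrable_on: "renewal_integrand integrable_on {0..t0}"
  by (rule set_borel_integral_eq_integral(1)[OF renewal_integrand_set_integrable])

end

end

section \<open>Solving the renewal equation\<close>

context sale_problem
begin

text \<open>The renewal equation shows first that \<open>u\<close> is continuous and then, through the right continuity of
its integrand, that \<open>u\<close> has the right derivative \<open>\<lambda> (1 - F (\<mu> t)) (K t - u t)\<close>. Together with the
equation for \<open>p t = \<phi> (\<mu> t)\<close>, the function \<open>(u - K) / p + J\<close> has right derivative \<open>0\<close>, and it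
vanishes at \<open>0\<close>.\<close>
lemma expected_solution:
  assumes t0: "0 \<le> t0"
    and K_measurable: "K \<in> borel_measurable borel"
    and K_cont: "continuous_on {0..t0} K"
    and K_der: "\<And>t. 0 \<le> t \<Longrightarrow> t < t0 \<Longrightarrow> (K has_real_derivative k t) (at_right t)"
    and J_cont: "continuous_on {0..t0} J" and J_0: "J 0 = 0"
    and J_der: "\<And>t. 0 \<le> t \<Longrightarrow> t < t0 \<Longrightarrow> (J has_real_derivative k t / phi F (\<mu> t)) (at_right t)"
  shows "expected K t0 = K t0 - phi F (\<mu> t0) * J t0"
proof -
  obtain B where B: "\<And>r. r \<in> {0..t0} \<Longrightarrow> \<bar>K r\<bar> \<le> B"
    using compact_imp_bounded[OF compact_continuous_image[OF K_cont compact_Icc]]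
    unfolding bounded_iff by (metis imageI real_norm_def)
  define u where "u = expected K"
  define g where "g r = lam * exp (lam * r) * ((1 - F (\<mu> (max r 0))) * K r + F (\<mu> (max r 0)) * u r)" for r
  have g_int: "g integrable_on {0..t0}"
    unfolding g_def[abs_def] u_def by (rule renewal_integrand_integrable_on[OF K_measurable B])
  have u_eq: "u t = exp (- (lam * t)) * (K 0 + integral {0..t} g)" if "t \<in> {0..t0}" for t
    using expected_renewal[OF K_measurable B that] unfolding g_def[abs_def] u_def
    by (simp add: exp_minus field_simps)
  have u_cont: "continuous_on {0..t0} u"
    using g_int by (subst continuous_on_cong[OF refl u_eq])
      (auto intro!: continuous_intros indefinite_integral_continuous_1)
  note at_right_cont = continuous_on_imp_continuous_at_right[where a = 0 and b = t0]
  have g_cont: "continuous (at_right t) g" if "0 \<le> t" "t < t0" for t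
  proof -
    have "((\<lambda>s. F (\<mu> (max s 0))) \<longlongrightarrow> F (\<mu> t)) (at_right t)"
    proof (rule Lim_transform_eventually)
      show "((\<lambda>s. F (\<mu> s)) \<longlongrightarrow> F (\<mu> t)) (at_right t)"
        using F_policy_right_continuous[OF that(1)] by (simp add: continuous_within)
      show "\<forall>\<^sub>F s in at_right t. F (\<mu> s) = F (\<mu> (max s 0))"
        using eventually_at_right_less[of t] by eventually_elim (use that in \<open>simp add: max_def\<close>)
    qed
    then have "continuous (at_right t) (\<lambda>s. F (\<mu> (max s 0)))"
      using that by (simp add: continuous_within max_def)
    then show ?thesis
      unfolding g_def[abs_def] using at_right_cont[OF K_cont that] at_right_cont[OF u_cont that]
      by (intro continuous_intros)
  qed
  have u_der: "(u has_real_derivative lam * (1 - F (\<mu> t)) * (K t - u t)) (at_right t)"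
    if t: "0 \<le> t" "t < t0" for t
  proof -
    let ?U = "\<lambda>t. exp (- (lam * t)) * (K 0 + integral {0..t} g)"
    have "(?U has_real_derivative exp (- (lam * t)) * g t + - lam * exp (- (lam * t)) * (K 0 + integral {0..t} g)) (at_right t)"
      by (rule derivative_eq_intros integral_right_derivative[OF g_int t g_cont[OF t]] refl | simp)+
    also have "exp (- (lam * t)) * g t + - lam * exp (- (lam * t)) * (K 0 + integral {0..t} g)
        = lam * ((1 - F (\<mu> t)) * K t + F (\<mu> t) * u t) - lam * u t"
      using t by (simp add: g_def u_eq max_def exp_minus field_simps)
    also have "\<dots> = lam * (1 - F (\<mu> t)) * (K t - u t)" by (simp add: algebra_simps)
    finally have "(?U has_real_derivative lam * (1 - F (\<mu> t)) * (K t - u t)) (at t within {t..t0})"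
      using t by (simp add: at_within_Icc_at_right)
    then have "(u has_real_derivative lam * (1 - F (\<mu> t)) * (K t - u t)) (at t within {t..t0})"
      by (rule has_field_derivative_transform_within[OF _ zero_less_one]) (use t u_eq in auto)
    then show ?thesis using t by (simp add: at_within_Icc_at_right)
  qed
  define p where "p t = phi F (\<mu> t)" for t
  have p_pos: "0 < p t" if "0 \<le> t" for t using that phi_policy_pos by (simp add: p_def)
  define f where "f t = (u t - K t) / p t + J t" for t
  have "f t0 = f 0"
  proof (rule zero_right_derivative_imp_constant[OF t0])
    show "continuous_on {0..t0} f"
      unfolding f_def p_def using phi_policy_pos
      by (intro continuous_intros u_cont K_cont J_cont continuous_on_subset[OF phi_policy_continuous])
        (auto simp: less_le)
    fix t assume t: "0 \<le> t" "t < t0"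
    have "(p has_real_derivative - (1 - F (\<mu> t)) * (lam * p t)) (at_right t)"
      unfolding p_def by (rule phi_policy_right_derivative[OF t(1)])
    then have "(f has_real_derivative
      ((lam * (1 - F (\<mu> t)) * (K t - u t) - k t) * p t - (u t - K t) * (- (1 - F (\<mu> t)) * (lam * p t)))
        / (p t * p t) + k t / p t) (at_right t)"
      unfolding f_def
      using J_der[OF t] p_pos[OF t(1)]
      by (intro DERIV_add DERIV_divide DERIV_diff u_der K_der t) (auto simp flip: p_def)
    also have "((lam * (1 - F (\<mu> t)) * (K t - u t) - k t) * p t - (u t - K t) * (- (1 - F (\<mu> t)) * (lam * p t)))
        / (p t * p t) + k t / p t = 0"
      using p_pos[OF t(1)] by (simp add: field_simps)
    finally show "(f has_real_derivative 0) (at_right t)" .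
  qed
  moreover have "u 0 = K 0" using u_eq[of 0] t0 by simp
  ultimately have "(u t0 - K t0) / p t0 + J t0 = 0" using J_0 by (simp add: f_def)
  then show ?thesis
    using p_pos[OF t0] by (simp add: u_def p_def field_simps)
qed

lemma integral_upto_policy:
  assumes "continuous_on {m..\<mu> b} f" "0 \<le> b"
  shows "continuous_on {0..b} (\<lambda>s. integral {m..\<mu> s} f)"
    and "0 \<le> t \<Longrightarrow> t < b \<Longrightarrow>
      ((\<lambda>s. integral {m..\<mu> s} f) has_real_derivative f (\<mu> t) * (lam * phi F (\<mu> t))) (at_right t)"
proof -
  have int: "f integrable_on {m..\<mu> b}" by (rule integrable_continuous_real[OF assms(1)])
  show "continuous_on {0..b} (\<lambda>s. integral {m..\<mu> s} f)"
    using m_le_policy policy_mono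
    by (intro continuous_on_compose2[OF indefinite_integral_continuous_1[OF int]]
        continuous_on_subset[OF policy_continuous]) auto
  assume t: "0 \<le> t" "t < b"
  have "m \<le> \<mu> t" "\<mu> t < \<mu> b" using t m_le_policy policy_strict_mono by auto
  then have "continuous (at_right (\<mu> t)) f"
    by (rule continuous_on_imp_continuous_at_right[OF assms(1)])
  then show "((\<lambda>s. integral {m..\<mu> s} f) has_real_derivative f (\<mu> t) * (lam * phi F (\<mu> t))) (at_right t)"
    using t \<open>m \<le> \<mu> t\<close> \<open>\<mu> t < \<mu> b\<close>
    by (intro right_derivative_compose_policy integral_right_derivative[OF int])
qed

lemma reciprocal_phi_square_continuous:
  assumes "0 \<le> b"
  shows "continuous_on {m..\<mu> b} (\<lambda>w. 1 / (phi F w)\<^sup>2)"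
  using continuous_on_power[OF reciprocal_phi_continuous[OF policy_in_price_range[OF assms]], of 2]
  by (simp add: power_divide)

lemma nested_integrand_continuous:
  assumes "0 \<le> b"
  shows "continuous_on {m..\<mu> b} (\<lambda>u. 1 / phi F u * integral {m..u} (\<lambda>w. 1 / (phi F w)\<^sup>2))"
  by (intro continuous_on_mult reciprocal_phi_continuous policy_in_price_range assms
      indefinite_integral_continuous_1 integrable_continuous_real reciprocal_phi_square_continuous)

text \<open>With \<open>p t = \<phi> (\<mu> t)\<close> these are the primitives \<open>A\<close> of \<open>1 / p\<close> and \<open>B\<close> of \<open>A\<close> that vanish at \<open>0\<close>.\<close>
abbreviation first_integral :: "real \<Rightarrow> real" where
  "first_integral t \<equiv> integral {m..\<mu> t} (\<lambda>w. 1 / (phi F w)\<^sup>2) / lam"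

abbreviation second_integral :: "real \<Rightarrow> real" where
  "second_integral t \<equiv>
     integral {m..\<mu> t} (\<lambda>u. 1 / phi F u * integral {m..u} (\<lambda>w. 1 / (phi F w)\<^sup>2)) / lam\<^sup>2"

lemma first_integral_right_derivative:
  assumes "0 \<le> t"
  shows "(first_integral has_real_derivative 1 / phi F (\<mu> t)) (at_right t)"
proof -
  have "(first_integral has_real_derivative 1 / (phi F (\<mu> t))\<^sup>2 * (lam * phi F (\<mu> t)) / lam) (at_right t)"
    using assms by (intro DERIV_cdivide integral_upto_policy(2)[of "t + 1"] reciprocal_phi_square_continuous) auto
  also have "1 / p\<^sup>2 * (lam * p) / lam = 1 / p" if "0 < p" for p
    using lam_pos that by (simp add: power2_eq_square)
  note this[OF phi_policy_pos[OF assms]]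
  finally show ?thesis .
qed

lemma second_integral_right_derivative:
  assumes "0 \<le> t"
  shows "(second_integral has_real_derivative first_integral t) (at_right t)"
proof -
  have "(second_integral has_real_derivative 1 / phi F (\<mu> t) * integral {m..\<mu> t} (\<lambda>w. 1 / (phi F w)\<^sup>2)
      * (lam * phi F (\<mu> t)) / lam\<^sup>2) (at_right t)"
    using assms by (intro DERIV_cdivide integral_upto_policy(2)[of "t + 1"] nested_integrand_continuous) auto
  also have "1 / p * c * (lam * p) / lam\<^sup>2 = c / lam" if "0 < p" for p c
    using lam_pos that by (simp add: power2_eq_square)
  note this[OF phi_policy_pos[OF assms]]
  finally show ?thesis .
qed

lemma first_integral_continuous: "0 \<le> b \<Longrightarrow> continuous_on {0..b} first_integral"
  using lam_pos
  by (intro continuous_on_divide continuous_on_const integral_upto_policy(1) reciprocal_phi_square_continuous) auto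

lemma second_integral_continuous: "0 \<le> b \<Longrightarrow> continuous_on {0..b} second_integral"
  using lam_pos
  by (intro continuous_on_divide continuous_on_const integral_upto_policy(1) nested_integrand_continuous) auto

lemma expected_elapsed:
  assumes "0 \<le> t"
  shows "expected (\<lambda>r. t - r) t = phi F (\<mu> t) * first_integral t"
proof -
  have "expected (\<lambda>r. t - r) t = (t - t) - phi F (\<mu> t) * (- first_integral t)"
  proof (rule expected_solution[OF assms, where k = "\<lambda>_. -1" and J = "\<lambda>s. - first_integral s"])
    show "((\<lambda>s. - first_integral s) has_real_derivative - 1 / phi F (\<mu> s)) (at_right s)" if "0 \<le> s" for s
      using DERIV_minus[OF first_integral_right_derivative[OF that]] by simp
    show "continuous_on {0..t} (\<lambda>s. - first_integral s)"
      by (intro continuous_on_minus first_integral_continuous assms)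
    show "((\<lambda>r. t - r) has_real_derivative - 1) (at_right s)" for s
      by (auto intro!: derivative_eq_intros)
  qed (simp_all add: policy_0 continuous_on_diff)
  then show ?thesis by simp
qed

text \<open>With the primitives \<open>A\<close> of \<open>1 / p\<close> and \<open>B\<close> of \<open>A\<close>, the derivative of \<open>(t - s) A s + B s\<close> is
\<open>(t - s) / p s\<close>, because the terms \<open>A s\<close> cancel.\<close>
lemma expected_elapsed_square:
  assumes "0 \<le> t"
  shows "expected (\<lambda>r. (t - r)\<^sup>2) t = 2 * phi F (\<mu> t) * second_integral t"
proof -
  let ?J = "\<lambda>s. - 2 * ((t - s) * first_integral s + second_integral s)"
  have "expected (\<lambda>r. (t - r)\<^sup>2) t = (t - t)\<^sup>2 - phi F (\<mu> t) * ?J t"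
  proof (rule expected_solution[OF assms, where k = "\<lambda>s. - 2 * (t - s)" and J = ?J])
    fix s :: real assume s: "0 \<le> s"
    have "(?J has_real_derivative
        - 2 * (((0 - 1) * first_integral s + 1 / phi F (\<mu> s) * (t - s)) + first_integral s)) (at_right s)"
      by (intro DERIV_cmult DERIV_add DERIV_mult DERIV_diff DERIV_const DERIV_ident
          first_integral_right_derivative second_integral_right_derivative s)
    also have "- 2 * (((0 - 1) * first_integral s + 1 / phi F (\<mu> s) * (t - s)) + first_integral s)
        = - 2 * (t - s) / phi F (\<mu> s)"
      by (simp add: field_simps)
    finally show "(?J has_real_derivative - 2 * (t - s) / phi F (\<mu> s)) (at_right s)" .
  next
    show "continuous_on {0..t} ?J"
      by (intro continuous_on_add continuous_on_mult continuous_on_diff continuous_on_const continuous_on_id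
          first_integral_continuous second_integral_continuous assms)
    show "((\<lambda>r. (t - r)\<^sup>2) has_real_derivative - 2 * (t - s)) (at_right s)" for s
      by (auto intro!: derivative_eq_intros)
  qed (simp_all add: policy_0 continuous_on_diff continuous_on_power)
  then show ?thesis by simp
qed

end

section \<open>From the given process to the sequence space\<close>

lemma time_to_sale_cong:
  assumes "\<And>i. i \<ge> 1 \<Longrightarrow> d i = d' i" "\<And>i. i \<ge> 1 \<Longrightarrow> x i = x' i"
  shows "time_to_sale pol d x t = time_to_sale pol d' x' t"
proof -
  have "remaining d t i = remaining d' t i" for i
    by (induction i) (use assms(1) in auto)
  moreover from this have "accepted pol d x t = accepted pol d' x' t"
    using assms(2) by (auto simp: accepted_def fun_eq_iff)
  ultimately show ?thesis by (simp add: time_to_sale_def)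
qed

text \<open>Grouping an independent family indexed by a disjoint sum into the pairs with equal index yields
independent pairs with independent components.\<close>
lemma (in prob_space) distr_interleaved_pairs:
  fixes D X :: "nat \<Rightarrow> 'a \<Rightarrow> real"
  assumes indep: "indep_vars (\<lambda>_. borel) (case_sum D X) ({1..} <+> {1..})"
    and D: "\<And>i. i \<ge> 1 \<Longrightarrow> distr M borel (D i) = A"
    and X: "\<And>i. i \<ge> 1 \<Longrightarrow> distr M borel (X i) = B"
  shows "distr M (\<Pi>\<^sub>M i\<in>UNIV. borel \<Otimes>\<^sub>M borel) (\<lambda>\<omega> i. (D (Suc i) \<omega>, X (Suc i) \<omega>)) =
      (\<Pi>\<^sub>M i\<in>UNIV. A \<Otimes>\<^sub>M B)"
proof -
  define L where "L i = {Inl (Suc i), Inr (Suc i) :: nat + nat}" for i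
  let ?Z = "\<lambda>i \<omega>. (D (Suc i) \<omega>, X (Suc i) \<omega>)"
  have "indep_vars (\<lambda>i. PiM (L i) (\<lambda>_. borel)) (\<lambda>i \<omega>. restrict (\<lambda>j. case_sum D X j \<omega>) (L i)) UNIV"
    by (rule indep_vars_restrict[OF indep]) (auto simp: L_def disjoint_family_on_def)
  then have "indep_vars (\<lambda>_. borel \<Otimes>\<^sub>M borel)
      (\<lambda>i \<omega>. (\<lambda>f. (f (Inl (Suc i)), f (Inr (Suc i)))) (restrict (\<lambda>j. case_sum D X j \<omega>) (L i))) UNIV"
    by (rule indep_vars_compose2)
      (auto intro!: measurable_Pair measurable_component_singleton simp: L_def)
  then have Z: "indep_vars (\<lambda>_. borel \<Otimes>\<^sub>M borel) ?Z UNIV"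
    by (simp add: L_def)
  have rv: "random_variable (borel \<Otimes>\<^sub>M borel) (?Z i)" for i
    using Z by (simp add: indep_vars_def)
  have pair: "distr M (borel \<Otimes>\<^sub>M borel) (?Z i) = A \<Otimes>\<^sub>M B" for i
  proof -
    have "indep_var (PiM {Inl (Suc i)} (\<lambda>_. borel)) (\<lambda>\<omega>. restrict (\<lambda>j. case_sum D X j \<omega>) {Inl (Suc i)})
        (PiM {Inr (Suc i)} (\<lambda>_. borel)) (\<lambda>\<omega>. restrict (\<lambda>j. case_sum D X j \<omega>) {Inr (Suc i)})"
      by (rule indep_var_restrict[OF indep]) auto
    then have "indep_var borel ((\<lambda>f. f (Inl (Suc i))) \<circ> (\<lambda>\<omega>. restrict (\<lambda>j. case_sum D X j \<omega>) {Inl (Suc i)}))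
        borel ((\<lambda>f. f (Inr (Suc i))) \<circ> (\<lambda>\<omega>. restrict (\<lambda>j. case_sum D X j \<omega>) {Inr (Suc i)}))"
      by (rule indep_var_compose) (auto intro!: measurable_component_singleton)
    then have "indep_var borel (D (Suc i)) borel (X (Suc i))" by (simp add: o_def)
    then show ?thesis
      using D[of "Suc i"] X[of "Suc i"] by (simp add: indep_var_distribution_eq)
  qed
  have "distr M (\<Pi>\<^sub>M i\<in>UNIV. borel \<Otimes>\<^sub>M borel) (\<lambda>\<omega>. \<lambda>i\<in>UNIV. ?Z i \<omega>) =
      (\<Pi>\<^sub>M i\<in>UNIV. distr M (borel \<Otimes>\<^sub>M borel) (?Z i))"
    using Z rv by (subst (asm) indep_vars_iff_distr_eq_PiM') auto
  then show ?thesis by (simp add: pair restrict_UNIV)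
qed

context sale_problem
begin

lemma process_expectation:
  fixes P :: "'b measure" and D X :: "nat \<Rightarrow> 'b \<Rightarrow> real"
  assumes P: "prob_space P"
    and D: "\<And>i. i \<ge> 1 \<Longrightarrow> distributed P lborel (D i) (exponential_density lam)"
    and X: "\<And>i. i \<ge> 1 \<Longrightarrow> X i \<in> borel_measurable P \<and> cdf (distr P borel (X i)) = F"
    and indep: "prob_space.indep_vars P (\<lambda>_. borel) (case_sum D X) ({1..} <+> {1..})"
    and t: "0 \<le> t" and K: "continuous_on UNIV K"
  defines "T \<equiv> \<lambda>\<omega>. time_to_sale \<mu> (\<lambda>i. D i \<omega>) (\<lambda>i. X i \<omega>) t"
  shows "integrable P (\<lambda>\<omega>. K (T \<omega>))"
    and "(\<integral>\<omega>. K (T \<omega>) \<partial>P) = expected (\<lambda>r. K (t - r)) t"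
proof -
  interpret P: prob_space P by (rule P)
  let ?w = "\<lambda>\<omega> i. (D (Suc i) \<omega>, X (Suc i) \<omega>)"
  have D_distr: "distr P borel (D i) = delay_law" if "i \<ge> 1" for i
  proof -
    have "distr P borel (D i) = distr P lborel (D i)" by (rule distr_cong) simp_all
    then show ?thesis using D[OF that] by (simp add: distributed_def)
  qed
  have X_distr: "distr P borel (X i) = value_law" if "i \<ge> 1" for i
    using X[OF that] P.real_distribution_distr value_law.real_distribution_axioms
    by (intro cdf_unique) (auto simp: cdf_value_law)
  have sets_paths: "sets paths = sets (\<Pi>\<^sub>M i\<in>UNIV. borel \<Otimes>\<^sub>M borel)"
    by (intro sets_PiM_cong sets_pair_measure_cong) auto
  have distr_w: "distr P paths ?w = paths"
    using P.distr_interleaved_pairs[OF indep D_distr X_distr]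
    by (subst distr_cong[OF refl sets_paths refl]) auto
  have [measurable]: "?w \<in> measurable P paths"
  proof -
    have "?w \<in> measurable P (\<Pi>\<^sub>M i\<in>UNIV. borel \<Otimes>\<^sub>M borel)"
      using D X by (intro measurable_PiM_single') (auto intro!: measurable_Pair simp: distributed_def space_pair_measure)
    then show ?thesis by (simp add: measurable_cong_sets[OF refl sets_paths])
  qed
  have [measurable]: "K \<in> borel_measurable borel"
    by (rule borel_measurable_continuous_onI[OF K])
  have T: "K (T \<omega>) = (\<lambda>w. K (t - time_left t w)) (?w \<omega>)" for \<omega>
    unfolding T_def time_left_def
    by (simp, intro arg_cong[where f = K] time_to_sale_cong) auto
  have "continuous_on {0..t} (\<lambda>r. K (t - r))"
    by (intro continuous_on_compose2[OF K] continuous_intros) auto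
  then have "bounded ((\<lambda>r. K (t - r)) ` {0..t})"
    by (intro compact_imp_bounded compact_continuous_image) auto
  then obtain B where "\<forall>x\<in>(\<lambda>r. K (t - r)) ` {0..t}. norm x \<le> B"
    unfolding bounded_iff by auto
  then have B: "\<And>r. r \<in> {0..t} \<Longrightarrow> \<bar>K (t - r)\<bar> \<le> B" by auto
  have "integrable paths (\<lambda>w. K (t - time_left t w))"
    by (rule integrable_K_time_left[of "\<lambda>r. K (t - r)" t B t]) (use B t in auto)
  then show "integrable P (\<lambda>\<omega>. K (T \<omega>))"
    unfolding T by (subst (asm) distr_w[symmetric]) (simp add: integrable_distr_eq)
  show "(\<integral>\<omega>. K (T \<omega>) \<partial>P) = expected (\<lambda>r. K (t - r)) t"
  proof -
    have "(\<integral>w. K (t - time_left t w) \<partial>distr P paths ?w) = (\<integral>\<omega>. K (t - time_left t (?w \<omega>)) \<partial>P)"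
      by (rule integral_distr) measurable
    then show ?thesis unfolding T expected_def distr_w by simp
  qed
qed

end

theorem theorem4p2:
  fixes P :: "'a measure"
    and D X :: "nat \<Rightarrow> 'a \<Rightarrow> real"
    and F F0 \<mu> :: "real \<Rightarrow> real"
    and lam \<mu>0 t :: real
    and T :: "'a \<Rightarrow> real"
  assumes "lam > 0"
    and "is_cdf F" and "is_cdf F0"
    and "integrable (interval_measure F) (\<lambda>x. max x 0)"
    and "integrable (interval_measure F0) (\<lambda>x. \<bar>x\<bar>)"
    and "\<mu>0 = cdf_mean F0"
    and "0 \<le> \<mu>0" and "ereal \<mu>0 < upper_end F"
    and "\<mu> = policy lam F \<mu>0"
    and "prob_space P"
    and "\<And>i. i \<ge> 1 \<Longrightarrow> distributed P lborel (D i) (exponential_density lam)"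
    and "\<And>i. i \<ge> 1 \<Longrightarrow> X i \<in> borel_measurable P \<and> cdf (distr P borel (X i)) = F"
    and "prob_space.indep_vars P (\<lambda>_. borel) (case_sum D X) ({1..} <+> {1..})"
    and "t \<ge> 0"
    and "T = (\<lambda>\<omega>. time_to_sale \<mu> (\<lambda>i. D i \<omega>) (\<lambda>i. X i \<omega>) t)"
  shows "integrable P T \<and> integrable P (\<lambda>\<omega>. (T \<omega>)\<^sup>2) \<and>
    prob_space.expectation P T =
      1 / lam * phi F (\<mu> t) * (LINT w:{\<mu>0..\<mu> t}|lborel. 1 / (phi F w)\<^sup>2) \<and>
    prob_space.variance P T =
      1 / lam\<^sup>2 *
        (2 * phi F (\<mu> t) *
           (LINT u:{\<mu>0..\<mu> t}|lborel. 1 / phi F u *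
              (LINT w:{\<mu>0..u}|lborel. 1 / (phi F w)\<^sup>2))
         - (phi F (\<mu> t) * (LINT w:{\<mu>0..\<mu> t}|lborel. 1 / (phi F w)\<^sup>2))\<^sup>2)"
proof -
  interpret P: prob_space P by fact
  interpret S: sale_problem F lam \<mu>0
    using assms by unfold_locales auto
  note \<mu> = \<open>\<mu> = policy lam F \<mu>0\<close>
  note moment = S.process_expectation[OF assms(10-14), folded \<mu>]
  have int: "integrable P T" "integrable P (\<lambda>\<omega>. (T \<omega>)\<^sup>2)"
    unfolding assms(15) using moment(1)[of "\<lambda>x. x"] moment(1)[of "\<lambda>x. x\<^sup>2"]
    by (simp_all add: continuous_on_power)
  have I1: "(LINT w:{\<mu>0..v}|lborel. 1 / (phi F w)\<^sup>2) = integral {\<mu>0..v} (\<lambda>w. 1 / (phi F w)\<^sup>2)"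
    if "v \<le> \<mu> t" for v
    using that S.reciprocal_phi_square_continuous[OF \<open>t \<ge> 0\<close>]
    by (intro lborel_integral_eq_integral) (auto simp: \<mu> intro: continuous_on_subset)
  have "(LINT u:{\<mu>0..\<mu> t}|lborel. 1 / phi F u * (LINT w:{\<mu>0..u}|lborel. 1 / (phi F w)\<^sup>2)) =
      (LINT u:{\<mu>0..\<mu> t}|lborel. 1 / phi F u * integral {\<mu>0..u} (\<lambda>w. 1 / (phi F w)\<^sup>2))"
    by (intro set_lebesgue_integral_cong) (auto simp: I1)
  also have "\<dots> = integral {\<mu>0..\<mu> t} (\<lambda>u. 1 / phi F u * integral {\<mu>0..u} (\<lambda>w. 1 / (phi F w)\<^sup>2))"
    unfolding \<mu> by (intro lborel_integral_eq_integral S.nested_integrand_continuous \<open>t \<ge> 0\<close>)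
  finally have I2: "(LINT u:{\<mu>0..\<mu> t}|lborel. 1 / phi F u * (LINT w:{\<mu>0..u}|lborel. 1 / (phi F w)\<^sup>2)) =
    integral {\<mu>0..\<mu> t} (\<lambda>u. 1 / phi F u * integral {\<mu>0..u} (\<lambda>w. 1 / (phi F w)\<^sup>2))" .
  have T: "T = (\<lambda>\<omega>. time_to_sale \<mu> (\<lambda>i. D i \<omega>) (\<lambda>i. X i \<omega>) t)" by fact
  have "P.expectation T = S.expected (\<lambda>r. t - r) t"
    unfolding T by (rule moment(2)[of "\<lambda>x. x"]) (simp_all add: continuous_on_id)
  also have "\<dots> = 1 / lam * phi F (\<mu> t) * integral {\<mu>0..\<mu> t} (\<lambda>w. 1 / (phi F w)\<^sup>2)"
    unfolding S.expected_elapsed[OF \<open>t \<ge> 0\<close>, folded \<mu>] by simp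
  finally have E1: "P.expectation T =
      1 / lam * phi F (\<mu> t) * (LINT w:{\<mu>0..\<mu> t}|lborel. 1 / (phi F w)\<^sup>2)"
    unfolding I1[OF order_refl] .
  have "P.expectation (\<lambda>\<omega>. (T \<omega>)\<^sup>2) = S.expected (\<lambda>r. (t - r)\<^sup>2) t"
    unfolding T by (rule moment(2)[of "\<lambda>x. x\<^sup>2"]) (simp_all add: continuous_on_power)
  also have "\<dots> = 1 / lam\<^sup>2 * (2 * phi F (\<mu> t) *
      integral {\<mu>0..\<mu> t} (\<lambda>u. 1 / phi F u * integral {\<mu>0..u} (\<lambda>w. 1 / (phi F w)\<^sup>2)))"
    unfolding S.expected_elapsed_square[OF \<open>t \<ge> 0\<close>, folded \<mu>] by simp
  finally have E2: "P.expectation (\<lambda>\<omega>. (T \<omega>)\<^sup>2) = 1 / lam\<^sup>2 * (2 * phi F (\<mu> t) *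
      (LINT u:{\<mu>0..\<mu> t}|lborel. 1 / phi F u * (LINT w:{\<mu>0..u}|lborel. 1 / (phi F w)\<^sup>2)))"
    unfolding I2 .
  have "1 / lam\<^sup>2 * a - (1 / lam * p * c)\<^sup>2 = 1 / lam\<^sup>2 * (a - (p * c)\<^sup>2)" for a p c
    by (simp add: power_mult_distrib power_divide right_diff_distrib)
  note variance = P.variance_eq[OF int, unfolded E2 arg_cong[OF E1, of power2] this]
  show ?thesis by (intro conjI int E1 variance)
qed

end
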